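(* For every integer $k\ge 0$, $|I_k(231,321)|=1$, and the unique indecomposable permutation with $k$ inversions avoiding $231$ and $321$ is $(k+1)\,1\,2\,\cdots\,k$.
   Context: A permutation of length $n$ is a word $\pi=\pi_1\cdots\pi_n$ containing each of $1,\dots,n$ exactly once. The sum of permutations $\rho=\rho_1\cdots\rho_n$ and $\tau=\tau_1\cdots\tau_m$ is the permutation $\rho\oplus\tau=\rho_1\cdots\rho_n(n+\tau_1)\cdots(n+\tau_m)$ of length $n+m$. A permutation is decomposable if it equals $\rho\oplus\tau$ for some non-empty permutations $\rho,\tau$; a non-empty permutation that is not decomposable is indecomposable. An inversion of $\pi$ is a pair $(i,j)$ with $i<j$ and $\pi_i>\pi_j$. A permutation $\pi$ contains a permutation (pattern) $\tau=\tau_1\cdots\tau_m$ if there are indices $i_1<\dots<i_m$ such that $\pi_{i_1},\dots,\pi_{i_m}$ is order-isomorphic to $\tau_1,\dots,\tau_m$; otherwise $\pi$ avoids $\tau$. $I_k(\tau_1,\dots,\tau_r)$ denotes the (finite) set of all indecomposable permutations, of any length, with exactly $k$ inversions that avoid all of $\tau_1,\dots,\tau_r$. *)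

theory Defs
  imports Main
begin

text \<open>
  A permutation of length n is a word over 1, ..., n, represented as a list of naturals.
  Entries are counted from 1, as usual in one-line notation; list positions are counted from 0.
\<close>

definition is_perm :: "nat list \<Rightarrow> bool" where
  "is_perm w \<longleftrightarrow> distinct w \<and> set w = {1..length w}"

definition perm_sum :: "nat list \<Rightarrow> nat list \<Rightarrow> nat list" where
  "perm_sum r t = r @ map (\<lambda>x. length r + x) t"

definition decomposable :: "nat list \<Rightarrow> bool" where
  "decomposable w \<longleftrightarrow>
     (\<exists>r t. is_perm r \<and> is_perm t \<and> r \<noteq> [] \<and> t \<noteq> [] \<and> w = perm_sum r t)"

definition indecomposable :: "nat list \<Rightarrow> bool" where
  "indecomposable w \<longleftrightarrow> is_perm w \<and> w \<noteq> [] \<and> \<not> decomposable w"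

definition inversions :: "nat list \<Rightarrow> (nat \<times> nat) set" where
  "inversions w = {(i, j). i < j \<and> j < length w \<and> w ! i > w ! j}"

definition order_isomorphic :: "nat list \<Rightarrow> nat list \<Rightarrow> bool" where
  "order_isomorphic u v \<longleftrightarrow>
     length u = length v \<and>
     (\<forall>a < length u. \<forall>b < length u. u ! a < u ! b \<longleftrightarrow> v ! a < v ! b)"

text \<open>The list \<open>ps\<close> below is the increasing sequence of positions of an occurrence of \<open>t\<close>.\<close>

definition contains :: "nat list \<Rightarrow> nat list \<Rightarrow> bool" where
  "contains w t \<longleftrightarrow>
     (\<exists>ps. sorted_wrt (<) ps \<and> set ps \<subseteq> {..<length w} \<and>
           order_isomorphic (map (\<lambda>p. w ! p) ps) t)"

definition avoids :: "nat list \<Rightarrow> nat list \<Rightarrow> bool" where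
  "avoids w t \<longleftrightarrow> \<not> contains w t"

definition indecomposable_avoiders :: "nat \<Rightarrow> nat list set \<Rightarrow> nat list set" where
  "indecomposable_avoiders k T =
     {w. indecomposable w \<and> card (inversions w) = k \<and> (\<forall>t \<in> T. avoids w t)}"

end

theory Submission
  imports Defs
begin

text \<open>
  A permutation avoids \<open>231\<close> and \<open>321\<close> together exactly when no entry has two larger entries
  to its left (\<open>avoids_231_321_iff\<close>). Consider the largest entry of such a permutation.
  Every entry to its right already has one larger entry on its left, namely the maximum, and is
  therefore larger than everything that precedes the maximum. Hence the word splits as a sum
  immediately before the maximum (\<open>decomposable_if_prefix_below\<close>), and an indecomposable
  permutation must begin with its maximum (\<open>indecomposable_avoider_hd\<close>). All other entries
  then have the first one as their only larger predecessor, so they increase. Thus an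
  indecomposable avoider of length \<open>n\<close> is \<open>n 1 2 \<dots> (n - 1)\<close>; its \<open>n - 1\<close> inversions
  determine \<open>n\<close>.
\<close>

section \<open>Avoidance of 231 and 321\<close>

lemma is_perm_le_length:
  assumes "is_perm w" "i < length w"
  shows "w ! i \<le> length w"
  using assms nth_mem[of i w] by (auto simp: is_perm_def)

lemma contains_231_iff:
  "contains w [2, 3, 1] \<longleftrightarrow>
    (\<exists>i j l. i < j \<and> j < l \<and> l < length w \<and> w ! l < w ! i \<and> w ! i < w ! j)"
proof
  assume "contains w [2, 3, 1]"
  then obtain ps where ps: "sorted_wrt (<) ps" "set ps \<subseteq> {..<length w}"
    and iso: "order_isomorphic (map (\<lambda>p. w ! p) ps) [2, 3, 1]"
    by (auto simp: contains_def)
  then obtain i j l where "ps = [i, j, l]"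
    by (auto simp: order_isomorphic_def length_Suc_conv)
  then show "\<exists>i j l. i < j \<and> j < l \<and> l < length w \<and> w ! l < w ! i \<and> w ! i < w ! j"
    using ps iso by (auto simp: order_isomorphic_def All_less_Suc)
next
  assume "\<exists>i j l. i < j \<and> j < l \<and> l < length w \<and> w ! l < w ! i \<and> w ! i < w ! j"
  then obtain i j l where "i < j" "j < l" "l < length w" "w ! l < w ! i" "w ! i < w ! j"
    by blast
  then show "contains w [2, 3, 1]"
    unfolding contains_def
    by (intro exI[of _ "[i, j, l]"])
      (auto simp: order_isomorphic_def All_less_Suc)
qed

lemma contains_321_iff:
  "contains w [3, 2, 1] \<longleftrightarrow>
    (\<exists>i j l. i < j \<and> j < l \<and> l < length w \<and> w ! l < w ! j \<and> w ! j < w ! i)"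
proof
  assume "contains w [3, 2, 1]"
  then obtain ps where ps: "sorted_wrt (<) ps" "set ps \<subseteq> {..<length w}"
    and iso: "order_isomorphic (map (\<lambda>p. w ! p) ps) [3, 2, 1]"
    by (auto simp: contains_def)
  then obtain i j l where "ps = [i, j, l]"
    by (auto simp: order_isomorphic_def length_Suc_conv)
  then show "\<exists>i j l. i < j \<and> j < l \<and> l < length w \<and> w ! l < w ! j \<and> w ! j < w ! i"
    using ps iso by (auto simp: order_isomorphic_def All_less_Suc)
next
  assume "\<exists>i j l. i < j \<and> j < l \<and> l < length w \<and> w ! l < w ! j \<and> w ! j < w ! i"
  then obtain i j l where "i < j" "j < l" "l < length w" "w ! l < w ! j" "w ! j < w ! i"
    by blast
  then show "contains w [3, 2, 1]"
    unfolding contains_def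
    by (intro exI[of _ "[i, j, l]"])
      (auto simp: order_isomorphic_def All_less_Suc)
qed

lemma avoids_231_321_iff:
  assumes "distinct w"
  shows "avoids w [2, 3, 1] \<and> avoids w [3, 2, 1] \<longleftrightarrow>
    (\<forall>i j l. i < j \<longrightarrow> j < l \<longrightarrow> l < length w \<longrightarrow> w ! i < w ! l \<or> w ! j < w ! l)"
    (is "?A \<longleftrightarrow> ?B")
proof
  assume A: ?A
  show ?B
  proof (intro allI impI)
    fix i j l assume ijl: "i < j" "j < l" "l < length w"
    then have "w ! i \<noteq> w ! j" "w ! i \<noteq> w ! l" "w ! j \<noteq> w ! l"
      using assms by (auto simp: nth_eq_iff_index_eq)
    moreover have "\<not> (w ! l < w ! i \<and> w ! i < w ! j)" "\<not> (w ! l < w ! j \<and> w ! j < w ! i)"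
      using A ijl unfolding avoids_def contains_231_iff contains_321_iff by blast+
    ultimately show "w ! i < w ! l \<or> w ! j < w ! l"
      by linarith
  qed
next
  assume ?B
  then show ?A
    unfolding avoids_def contains_231_iff contains_321_iff
    by (meson less_asym less_trans)
qed

section \<open>Indecomposable avoiders\<close>

lemma decomposable_if_prefix_below:
  assumes perm: "is_perm w" and p: "0 < p" "p < length w"
    and below: "\<And>x y. x \<in> set (take p w) \<Longrightarrow> y \<in> set (drop p w) \<Longrightarrow> x < y"
  shows "decomposable w"
proof -
  let ?A = "set (take p w)" and ?B = "set (drop p w)"
  let ?t = "map (\<lambda>x. x - p) (drop p w)"
  have un: "?A \<union> ?B = {1..length w}"
    using perm by (metis append_take_drop_id is_perm_def set_append)
  have dist: "distinct w"
    using perm by (simp add: is_perm_def)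
  have cardA: "card ?A = p"
    using dist p by (simp add: distinct_card)
  then have ne: "?A \<noteq> {}"
    using p by force
  have max: "Max ?A \<in> ?A"
    using ne by simp
  \<comment> \<open>The prefix is downward closed, so its values form an initial segment.\<close>
  have initial: "?A = {1..Max ?A}"
  proof (intro equalityI subsetI)
    fix x assume "x \<in> ?A"
    then show "x \<in> {1..Max ?A}"
      using un by auto
  next
    fix x assume x: "x \<in> {1..Max ?A}"
    then have "x \<in> ?A \<union> ?B"
      using un subsetD[OF Un_upper1 max, of ?B] by auto
    then show "x \<in> ?A"
      using below[OF max, of x] x by auto
  qed
  moreover have "Max ?A = p"
    using cardA arg_cong[OF initial, of card] by simp
  ultimately have A: "?A = {1..p}"
    by metis
  have disj: "?A \<inter> ?B = {}"
    using below by blast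
  have "?B = {1..length w} - {1..p}"
    using un disj A by blast
  also have "\<dots> = {p + 1..length w}"
    by auto
  finally have B: "?B = {p + 1..length w}" .
  have "is_perm (take p w)"
    using A dist p by (simp add: is_perm_def)
  moreover have "is_perm ?t"
  proof -
    have "distinct ?t"
      using dist B by (auto simp: distinct_map inj_on_def)
    moreover have "(\<lambda>x. x - p) ` {p + 1..length w} = {1..length w - p}"
    proof (intro equalityI subsetI)
      fix x assume "x \<in> {1..length w - p}"
      then show "x \<in> (\<lambda>x. x - p) ` {p + 1..length w}"
        by (intro image_eqI[of _ _ "x + p"]) auto
    qed auto
    ultimately show ?thesis
      using B by (simp add: is_perm_def)
  qed
  moreover have "map (\<lambda>x. p + x) ?t = drop p w"
    unfolding map_map by (intro map_idI) (simp add: B)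
  then have "w = perm_sum (take p w) ?t"
    using p by (simp add: perm_sum_def)
  moreover have "take p w \<noteq> []" "?t \<noteq> []"
    using p by auto
  ultimately show ?thesis
    unfolding decomposable_def by blast
qed

lemma indecomposable_avoider_hd:
  assumes ind: "indecomposable w" and av: "avoids w [2, 3, 1]" "avoids w [3, 2, 1]"
  shows "w ! 0 = length w"
proof -
  have perm: "is_perm w" and ne: "w \<noteq> []" and nd: "\<not> decomposable w"
    using ind by (auto simp: indecomposable_def)
  have dist: "distinct w"
    using perm by (simp add: is_perm_def)
  have "length w \<in> set w"
    using perm ne by (auto simp: is_perm_def Suc_le_eq)
  then obtain p where p: "p < length w" "w ! p = length w"
    by (auto simp: in_set_conv_nth)
  have "p = 0"
  proof (rule ccontr)
    assume "p \<noteq> 0"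
    have "x < y" if x: "x \<in> set (take p w)" and y: "y \<in> set (drop p w)" for x y
    proof -
      obtain i where i: "i < p" "x = w ! i"
        using x p by (auto simp: in_set_conv_nth)
      obtain d where "d < length w - p" "y = w ! (p + d)"
        using y p by (auto simp: in_set_conv_nth)
      then obtain j where j: "p \<le> j" "j < length w" "y = w ! j"
        using that[of "p + d"] by simp
      have le: "w ! i \<le> w ! p" "w ! j \<le> w ! p"
        using is_perm_le_length[OF perm] i j p by auto
      show "x < y"
      proof (cases "j = p")
        case True
        then show ?thesis
          using le i j p dist by (metis le_neq_implies_less less_trans nat_neq_iff nth_eq_iff_index_eq)
      next
        case False
        \<comment> \<open>The maximum at \<open>p\<close> exceeds \<open>w ! j\<close>, so the earlier entry \<open>w ! i\<close> cannot.\<close>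
        then have "w ! i < w ! j \<or> w ! p < w ! j"
          using av avoids_231_321_iff[OF dist] i j by (metis le_neq_implies_less)
        then show ?thesis
          using le i j by auto
      qed
    qed
    then have "decomposable w"
      using decomposable_if_prefix_below[OF perm _ p(1)] \<open>p \<noteq> 0\<close> by blast
    then show False
      using nd by blast
  qed
  then show ?thesis
    using p by simp
qed

lemma indecomposable_avoider_eq:
  assumes ind: "indecomposable w" and av: "avoids w [2, 3, 1]" "avoids w [3, 2, 1]"
  shows "w = length w # [1..<length w]"
proof -
  have perm: "is_perm w" and ne: "w \<noteq> []"
    using ind by (auto simp: indecomposable_def)
  have dist: "distinct w"
    using perm by (simp add: is_perm_def)
  obtain xs where w: "w = length w # xs"
    using indecomposable_avoider_hd[OF assms] ne by (cases w) auto
  then have len: "length w = Suc (length xs)"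
    by (metis length_Cons)
  have nth: "w ! Suc i = xs ! i" for i
    using w by (metis nth_Cons_Suc)
  have "sorted_wrt (<) xs"
    unfolding sorted_wrt_iff_nth_less
  proof (intro allI impI)
    fix i j assume ij: "i < j" "j < length xs"
    \<comment> \<open>The first entry of \<open>w\<close> serves as one larger predecessor of each later entry.\<close>
    then have "w ! 0 < w ! Suc j \<or> w ! Suc i < w ! Suc j"
      using av avoids_231_321_iff[OF dist] len by (metis Suc_less_eq zero_less_Suc)
    moreover have "w ! Suc j \<le> w ! 0"
      using is_perm_le_length[OF perm, of "Suc j"] indecomposable_avoider_hd[OF assms] ij len
      by simp
    ultimately show "xs ! i < xs ! j"
      by (simp add: nth)
  qed
  moreover have "set xs = set [1..<length w]"
  proof -
    have "insert (length w) (set xs) = {1..length w}" "length w \<notin> set xs"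
      using perm dist w by (metis is_perm_def list.simps(15), metis distinct.simps(2))
    then have "set xs = {1..length w} - {length w}"
      by blast
    also have "\<dots> = set [1..<length w]"
      by auto
    finally show ?thesis .
  qed
  ultimately have "xs = [1..<length w]"
    by (intro strict_sorted_equal) auto
  with w show ?thesis
    by metis
qed

section \<open>The permutation with its maximum moved to the front\<close>

lemma max_first_nth:
  assumes "0 < i" "i < k + 1"
  shows "((k + 1) # [1..<k + 1]) ! i = i"
  using assms by (cases i) (auto simp del: upt_Suc)

lemma inversions_max_first:
  "inversions ((k + 1) # [1..<k + 1]) = {0} \<times> {1..k}"
proof (intro set_eqI)
  fix x :: "nat \<times> nat"
  obtain i j where "x = (i, j)"
    by (cases x)
  then show "x \<in> inversions ((k + 1) # [1..<k + 1]) \<longleftrightarrow> x \<in> {0} \<times> {1..k}"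
    using max_first_nth[of i k] max_first_nth[of j k]
    by (cases "i = 0") (auto simp: inversions_def simp del: upt_Suc)
qed

lemma is_perm_max_first: "is_perm ((k + 1) # [1..<k + 1])"
  by (auto simp: is_perm_def simp del: upt_Suc)

lemma indecomposable_max_first: "indecomposable ((k + 1) # [1..<k + 1])"
proof -
  have "\<not> decomposable ((k + 1) # [1..<k + 1])"
  proof
    assume "decomposable ((k + 1) # [1..<k + 1])"
    then obtain r t where r: "is_perm r" "r \<noteq> []" and t: "t \<noteq> []"
      and eq: "(k + 1) # [1..<k + 1] = perm_sum r t"
      unfolding decomposable_def by blast
    \<comment> \<open>The first summand contains the maximum, which leaves no room for a second summand.\<close>
    have "length r + length t = k + 1"
      using arg_cong[OF eq, of length] by (simp add: perm_sum_def del: upt_Suc)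
    moreover have "r ! 0 = k + 1"
      using arg_cong[OF eq, of "\<lambda>v. v ! 0"] r by (simp add: perm_sum_def nth_append)
    moreover have "r ! 0 \<le> length r"
      using is_perm_le_length r by blast
    ultimately show False
      using t by (cases t) auto
  qed
  then show ?thesis
    using is_perm_max_first by (simp add: indecomposable_def del: upt_Suc)
qed

lemma avoids_max_first:
  "avoids ((k + 1) # [1..<k + 1]) [2, 3, 1] \<and> avoids ((k + 1) # [1..<k + 1]) [3, 2, 1]"
proof (subst avoids_231_321_iff)
  show "distinct ((k + 1) # [1..<k + 1])"
    by simp
  show "\<forall>i j l. i < j \<longrightarrow> j < l \<longrightarrow> l < length ((k + 1) # [1..<k + 1]) \<longrightarrow>
      ((k + 1) # [1..<k + 1]) ! i < ((k + 1) # [1..<k + 1]) ! l \<or>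
      ((k + 1) # [1..<k + 1]) ! j < ((k + 1) # [1..<k + 1]) ! l"
  proof (intro allI impI disjI2)
    fix i j l assume "i < j" "j < l" "l < length ((k + 1) # [1..<k + 1])"
    then show "((k + 1) # [1..<k + 1]) ! j < ((k + 1) # [1..<k + 1]) ! l"
      using max_first_nth[of j k] max_first_nth[of l k] by (simp del: upt_Suc)
  qed
qed

section \<open>Enumeration by inversions\<close>

theorem theorem10:
  fixes k :: nat
  shows "card (indecomposable_avoiders k {[2, 3, 1], [3, 2, 1]}) = 1 \<and>
         indecomposable_avoiders k {[2, 3, 1], [3, 2, 1]} = {(k + 1) # [1..<k + 1]}"
proof -
  have "indecomposable_avoiders k {[2, 3, 1], [3, 2, 1]} = {(k + 1) # [1..<k + 1]}"
  proof (intro equalityI subsetI)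
    fix w assume "w \<in> indecomposable_avoiders k {[2, 3, 1], [3, 2, 1]}"
    then have ind: "indecomposable w" and card: "card (inversions w) = k"
      and av: "avoids w [2, 3, 1]" "avoids w [3, 2, 1]"
      by (auto simp: indecomposable_avoiders_def)
    obtain m where m: "length w = m + 1"
      using ind by (cases w) (auto simp: indecomposable_def)
    then have w: "w = (m + 1) # [1..<m + 1]"
      using indecomposable_avoider_eq[OF ind av] by simp
    then have "m = k"
      using card inversions_max_first[of m] by (simp add: card_cartesian_product)
    with w show "w \<in> {(k + 1) # [1..<k + 1]}"
      by blast
  next
    fix w assume "w \<in> {(k + 1) # [1..<k + 1]}"
    then have "w = (k + 1) # [1..<k + 1]"
      by blast
    then show "w \<in> indecomposable_avoiders k {[2, 3, 1], [3, 2, 1]}"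
      unfolding indecomposable_avoiders_def
      using indecomposable_max_first[of k] avoids_max_first[of k] inversions_max_first[of k]
      by (simp add: card_cartesian_product del: upt_Suc)
  qed
  then show ?thesis
    by simp
qed

end
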